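(* For a real sequence $x = (x_n)_{n \ge 1}$ with $\sum_{k=1}^\infty x_k$ convergent, let $t(x)_n := \sum_{k=n}^\infty x_k$ for $n \ge 1$. Let $$K := \Big\{x = (x_i)_{i \ge 1} : \sum_{i=1}^\infty x_i = 0 \text{ and } \sum_{p=1}^\infty |t(x)_p + t(x)_{p+1}| < \infty\Big\},$$ a vector subspace of $c_0$ (membership in $K$ includes convergence of $\sum_i x_i$). Define $S : c_0 \rightrightarrows \ell_1$ as follows: if $x \in K$, then $Sx$ is the single element of $\ell_1$ given by $(Sx)_j := -t(x)_j - t(x)_{j+1}$ for all $j \ge 1$; if $x \in c_0 \setminus K$, then $Sx := \emptyset$. Then $S$ is skew and maximally monotone but not quasidense.
   Context: $c_0$ is the Banach space of real null sequences with the sup norm, with dual $\ell_1$ under $\langle x, x^*\rangle = \sum_i x_i x_i^*$. $S$ is single-valued and linear on $D(S) = K$; it is skew if $\langle x, Sx\rangle = 0$ for all $x \in K$. With $E := c_0$, $E^* = \ell_1$ and $G(S) := \{(x,Sx) : x \in K\}$: $S$ is maximally monotone if $G(S)$ is a maximally monotone subset of $E \times E^*$, and $S$ is quasidense if, for all $(x,x^* ) \in E \times E^*$, $\inf_{(s,s^* ) \in G(S)}\big[\frac12\|s-x\|^2 + \frac12\|s^*-x^*\|^2 + \langle s-x, s^*-x^*\rangle\big] \le 0$. *)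

theory Defs
  imports Complex_Main "HOL-Library.Extended_Real"
begin

text \<open>
  Sequences indexed by the positive integers are functions on \<open>nat\<close>; the entry \<open>x_i\<close>
  is \<open>x (i - 1)\<close>.  The spaces \<open>c_0\<close> and \<open>\<ell>_1\<close> are carrier sets of sequences with their norms
  as explicit functions, which are meaningful only on the respective carrier.
\<close>

type_synonym rseq = "nat \<Rightarrow> real"

definition c0 :: "rseq set" where
  "c0 = {x. x \<longlonglongrightarrow> 0}"

definition l1 :: "rseq set" where
  "l1 = {y. summable (\<lambda>i. \<bar>y i\<bar>)}"

definition c0_norm :: "rseq \<Rightarrow> real" where
  "c0_norm x = (SUP i. \<bar>x i\<bar>)"

definition l1_norm :: "rseq \<Rightarrow> real" where
  "l1_norm y = (\<Sum>i. \<bar>y i\<bar>)"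

definition pairing :: "rseq \<Rightarrow> rseq \<Rightarrow> real" where
  "pairing x y = (\<Sum>i. x i * y i)"


definition op_graph :: "(rseq \<Rightarrow> rseq set) \<Rightarrow> (rseq \<times> rseq) set" where
  "op_graph T = {(x, y). y \<in> T x}"

definition skew_op :: "(rseq \<Rightarrow> rseq set) \<Rightarrow> bool" where
  "skew_op T \<longleftrightarrow> (\<forall>(x, y) \<in> op_graph T. pairing x y = 0)"

definition monotone_set :: "(rseq \<times> rseq) set \<Rightarrow> bool" where
  "monotone_set A \<longleftrightarrow>
     A \<subseteq> c0 \<times> l1 \<and> (\<forall>(x, x') \<in> A. \<forall>(y, y') \<in> A. pairing (x - y) (x' - y') \<ge> 0)"

definition maximally_monotone_set :: "(rseq \<times> rseq) set \<Rightarrow> bool" where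
  "maximally_monotone_set A \<longleftrightarrow>
     monotone_set A \<and> (\<forall>B. monotone_set B \<longrightarrow> A \<subseteq> B \<longrightarrow> B = A)"

definition maximally_monotone_op :: "(rseq \<Rightarrow> rseq set) \<Rightarrow> bool" where
  "maximally_monotone_op T \<longleftrightarrow> maximally_monotone_set (op_graph T)"

text \<open>The infimum is taken in the extended reals, so that it is \<open>\<infinity>\<close> for an empty graph.\<close>

definition quasidense_op :: "(rseq \<Rightarrow> rseq set) \<Rightarrow> bool" where
  "quasidense_op T \<longleftrightarrow>
     (\<forall>x \<in> c0. \<forall>x' \<in> l1.
        (INF (s, s') \<in> op_graph T.
           ereal (1/2 * (c0_norm (s - x))\<^sup>2 + 1/2 * (l1_norm (s' - x'))\<^sup>2
                  + pairing (s - x) (s' - x'))) \<le> 0)"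


text \<open>The tail sum \<open>tail_sum x n\<close> is meaningful only if \<open>x\<close> is summable.\<close>

definition tail_sum :: "rseq \<Rightarrow> rseq" where
  "tail_sum x n = (\<Sum>k. x (n + k))"

definition K :: "rseq set" where
  "K = {x. x sums 0 \<and> summable (\<lambda>p. \<bar>tail_sum x p + tail_sum x (Suc p)\<bar>)}"

definition S :: "rseq \<Rightarrow> rseq set" where
  "S x = (if x \<in> K then {\<lambda>j. - tail_sum x j - tail_sum x (Suc j)} else {})"


text \<open>
  Well-definedness: \<open>K\<close> is a vector subspace of \<open>c_0\<close>, and \<open>S\<close> is a single-valued linear
  operator on \<open>K\<close> with values in \<open>\<ell>_1\<close>.
\<close>

lemma K_subset_c0: "K \<subseteq> c0"
  by (auto simp: K_def c0_def sums_iff intro: summable_LIMSEQ_zero)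

lemma tail_sum_lincomb:
  assumes "summable x" "summable y"
  shows "tail_sum (\<lambda>i. a * x i + b * y i) n = a * tail_sum x n + b * tail_sum y n"
proof -
  have x: "summable (\<lambda>k. x (n + k))" and y: "summable (\<lambda>k. y (n + k))"
    using assms summable_iff_shift[of x n] summable_iff_shift[of y n] by (simp_all add: add.commute)
  show ?thesis
    unfolding tail_sum_def
    using suminf_add[OF summable_mult[OF x, of a] summable_mult[OF y, of b]]
      suminf_mult[OF x, of a] suminf_mult[OF y, of b] by simp
qed

lemma zero_in_K: "(\<lambda>_. 0) \<in> K"
  by (simp add: K_def tail_sum_def)

lemma K_lincomb:
  assumes "x \<in> K" "y \<in> K"
  shows "(\<lambda>i. a * x i + b * y i) \<in> K"
proof -
  have x: "x sums 0" "summable (\<lambda>p. \<bar>tail_sum x p + tail_sum x (Suc p)\<bar>)"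
    and y: "y sums 0" "summable (\<lambda>p. \<bar>tail_sum y p + tail_sum y (Suc p)\<bar>)"
    using assms by (auto simp: K_def)
  have "(\<lambda>i. a * x i + b * y i) sums (a * 0 + b * 0)"
    by (intro sums_add sums_mult x y)
  moreover have "summable (\<lambda>p. \<bar>a\<bar> * \<bar>tail_sum x p + tail_sum x (Suc p)\<bar>
                             + \<bar>b\<bar> * \<bar>tail_sum y p + tail_sum y (Suc p)\<bar>)"
    by (intro summable_add summable_mult x y)
  then have "summable (\<lambda>p. \<bar>a * (tail_sum x p + tail_sum x (Suc p))
                             + b * (tail_sum y p + tail_sum y (Suc p))\<bar>)"
    by (rule summable_comparison_test[rotated])
      (auto simp flip: abs_mult intro!: exI[of _ 0] abs_triangle_ineq)
  ultimately show ?thesis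
    using x(1) y(1) by (simp add: K_def tail_sum_lincomb sums_iff algebra_simps)
qed

lemma S_subset_l1: "S x \<subseteq> l1"
proof -
  have "\<bar>- a - b\<bar> = \<bar>a + b\<bar>" for a b :: real
    by simp
  then show ?thesis
    by (auto simp: S_def K_def l1_def)
qed

lemma S_domain: "{x. S x \<noteq> {}} = K"
  by (simp add: S_def)

lemma S_lincomb:
  assumes "x \<in> K" "y \<in> K" "x' \<in> S x" "y' \<in> S y"
  shows "S (\<lambda>i. a * x i + b * y i) = {\<lambda>j. a * x' j + b * y' j}"
proof -
  have "summable x" "summable y"
    using assms(1,2) by (auto simp: K_def sums_iff)
  then show ?thesis
    using assms K_lincomb[OF assms(1,2), of a b]
    by (auto simp: S_def tail_sum_lincomb algebra_simps)
qed

end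

theory Submission imports Defs begin

text \<open>
  Every \<open>x\<close> with \<open>\<Sum>x = 0\<close> is determined by its tail sums \<open>t\<close>, where \<open>t 0 = 0\<close> and \<open>t \<longlonglongrightarrow> 0\<close>, and the
  entries of \<open>x\<close> and \<open>S x\<close> are \<open>t i - t (i + 1)\<close> and \<open>-(t i + t (i + 1))\<close>
  (\<open>op_graph_S_iff\<close>).  Everything is done in terms of \<open>t\<close>.

  The operator is skew because the product of these entries is minus a difference of squares, so
  that the pairing telescopes to \<open>-(t 0)\<^sup>2 = 0\<close>.

  For maximality, let \<open>(x, x')\<close> be monotonically related to the graph.  Testing against the
  graph elements whose tail sums are \<open>a\<close> times a unit vector, and letting \<open>a\<close> range over all
  reals, gives the recurrence \<open>x' (m + 1) - x' m = x m + x (m + 1)\<close>.  As \<open>x\<close> and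
  \<open>x'\<close> are null sequences, it follows that \<open>x\<close> is summable and that \<open>x'\<close> is given by the tail
  sums \<open>t\<close> of \<open>x\<close> just as on the graph.  Only \<open>t 0 = 0\<close> is left, and that
  follows from \<open>0 \<le> \<langle>x, x'\<rangle> = -(t 0)\<^sup>2\<close>.

  The failure of quasidensity comes from the bidual.  With \<open>x' = (1, 0, 0, \<dots>)\<close>, the bounded
  sequence \<open>\<xi> = (1, -2, 2, -2, \<dots>)\<close> satisfies \<open>\<langle>s, x'\<rangle> + \<langle>\<xi>, S s\<rangle> = 0\<close> for all \<open>s\<close>
  in \<open>K\<close>, while \<open>\<langle>\<xi>, x'\<rangle> = 1 > 0\<close>.  So by skewness \<open>\<langle>s - \<xi>, S s - x'\<rangle> = 1\<close> for all \<open>s\<close>, and a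
  positive lower bound would be immediate if \<open>\<xi>\<close> were in \<open>c0\<close>.  Cutting \<open>\<xi>\<close> off abruptly is not
  enough, but damping it linearly is: \<open>x = (1, -3/2, 1, -1/2, 0, \<dots>)\<close> turns the pairing
  into \<open>1 + (s 1 + s 3) / 2\<close>, and the two norms control \<open>s 1\<close> and \<open>s 3\<close>
  well enough to keep the functional above \<open>1/8\<close> (\<open>quasidensity_gap\<close>).
\<close>

section \<open>The spaces and their pairing\<close>

lemma c0_abs_le_norm:
  assumes "x \<in> c0"
  shows "\<bar>x i\<bar> \<le> c0_norm x"
proof -
  have "Bseq x"
    using assms by (auto simp: c0_def intro!: convergent_imp_Bseq convergentI)
  then obtain B where "\<And>i. \<bar>x i\<bar> \<le> B"
    by (auto simp: Bseq_def)
  then have "bdd_above (range (\<lambda>i. \<bar>x i\<bar>))"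
    by (intro bdd_aboveI2)
  then show ?thesis
    unfolding c0_norm_def by (rule cSUP_upper[rotated]) simp
qed

lemma summable_pairing:
  assumes "x \<in> c0" "y \<in> l1"
  shows "summable (\<lambda>i. x i * y i)"
proof (rule summable_comparison_test)
  show "\<exists>N. \<forall>n\<ge>N. norm (x n * y n) \<le> c0_norm x * \<bar>y n\<bar>"
    using c0_abs_le_norm[OF assms(1)] by (auto simp: abs_mult intro!: mult_right_mono)
  show "summable (\<lambda>n. c0_norm x * \<bar>y n\<bar>)"
    using assms(2) by (auto simp: l1_def intro: summable_mult)
qed

text \<open>When the cross terms are finite sums, the pairing of the differences can be expanded.\<close>

lemma pairing_diff_sums:
  fixes s s' x x' :: rseq
  assumes "(\<lambda>i. s i * s' i) sums a" "(\<lambda>i. x i * x' i) sums d"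
    and "(\<lambda>i. s i * x' i) sums b" "(\<lambda>i. x i * s' i) sums c"
  shows "pairing (s - x) (s' - x') = a - b - c + d"
proof -
  have "(\<lambda>i. s i * s' i - s i * x' i - x i * s' i + x i * x' i) sums (a - b - c + d)"
    by (intro sums_add sums_diff assms)
  then show ?thesis
    unfolding pairing_def by (simp add: sums_iff algebra_simps)
qed

section \<open>The graph in terms of tail sums\<close>

lemma telescoping_sums_null:
  fixes t :: rseq
  assumes "t \<longlonglongrightarrow> 0"
  shows "(\<lambda>i. t i - t (Suc i)) sums t 0"
  using telescope_sums'[OF assms] by simp

lemma tail_sum_of_differences:
  assumes "t \<longlonglongrightarrow> 0"
  shows "tail_sum (\<lambda>i. t i - t (Suc i)) = t"
proof
  fix n
  have "(\<lambda>i. t (n + i)) \<longlonglongrightarrow> 0"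
    using LIMSEQ_ignore_initial_segment[OF assms, of n] by (simp add: add.commute)
  from telescoping_sums_null[OF this] show "tail_sum (\<lambda>i. t i - t (Suc i)) n = t n"
    by (simp add: tail_sum_def sums_iff)
qed

lemma tail_sum_eq_sum_diff:
  assumes "x sums l"
  shows "tail_sum x n = l - (\<Sum>i<n. x i)"
  using suminf_minus_initial_segment[OF sums_summable[OF assms], of n] assms
  by (simp add: tail_sum_def sums_iff add.commute)

lemma tail_sum_null:
  assumes "x sums l"
  shows "tail_sum x \<longlonglongrightarrow> 0"
proof -
  have "(\<lambda>n. l - (\<Sum>i<n. x i)) \<longlonglongrightarrow> l - l"
    using assms by (intro tendsto_intros) (simp add: sums_def)
  moreover have "tail_sum x = (\<lambda>n. l - (\<Sum>i<n. x i))"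
    using tail_sum_eq_sum_diff[OF assms] by blast
  ultimately show ?thesis
    by simp
qed

text \<open>A null sequence \<open>t\<close> is the sequence of tail sums of its differences, so elements of the graph
  can be constructed by choosing \<open>t\<close>, and existing ones studied without infinite sums.\<close>

lemma op_graph_S_iff:
  "(x, y) \<in> op_graph S \<longleftrightarrow>
     (\<exists>t. t 0 = 0 \<and> t \<longlonglongrightarrow> 0 \<and> summable (\<lambda>p. \<bar>t p + t (Suc p)\<bar>) \<and>
          x = (\<lambda>i. t i - t (Suc i)) \<and> y = (\<lambda>i. - t i - t (Suc i)))"
    (is "?L \<longleftrightarrow> ?R")
proof
  assume ?L
  then have x: "x sums 0" "summable (\<lambda>p. \<bar>tail_sum x p + tail_sum x (Suc p)\<bar>)"
    and y: "y = (\<lambda>i. - tail_sum x i - tail_sum x (Suc i))"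
    by (auto simp: op_graph_def S_def K_def split: if_splits)
  show ?R
  proof (intro exI conjI)
    show "tail_sum x 0 = 0" "x = (\<lambda>i. tail_sum x i - tail_sum x (Suc i))"
      using tail_sum_eq_sum_diff[OF x(1)] by auto
  qed (use x y tail_sum_null in auto)
next
  assume ?R
  then obtain t where t: "t 0 = 0" "t \<longlonglongrightarrow> 0" "summable (\<lambda>p. \<bar>t p + t (Suc p)\<bar>)"
    "x = (\<lambda>i. t i - t (Suc i))" "y = (\<lambda>i. - t i - t (Suc i))"
    by blast
  then show ?L
    using tail_sum_of_differences[OF t(2)] telescoping_sums_null[OF t(2)]
    by (simp add: op_graph_def S_def K_def)
qed

lemma op_graph_S_subset: "op_graph S \<subseteq> c0 \<times> l1"
  using K_subset_c0 S_subset_l1 by (auto simp: op_graph_def S_def split: if_splits)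

text \<open>The product of the entries is \<open>-((t i)\<^sup>2 - (t (i + 1))\<^sup>2)\<close>.\<close>

lemma pairing_tails_sums:
  fixes t :: rseq
  assumes "t \<longlonglongrightarrow> 0"
  shows "(\<lambda>i. (t i - t (Suc i)) * (- t i - t (Suc i))) sums (- (t 0)\<^sup>2)"
proof -
  have "(\<lambda>i. (t i)\<^sup>2) \<longlonglongrightarrow> 0"
    using tendsto_power[OF assms, of 2] by simp
  from sums_minus[OF telescoping_sums_null[OF this]] show ?thesis
    by (simp add: power2_eq_square algebra_simps)
qed

lemma op_graph_S_pairing_sums:
  assumes "(x, y) \<in> op_graph S"
  shows "(\<lambda>i. x i * y i) sums 0"
proof -
  obtain t where t: "t 0 = 0" "t \<longlonglongrightarrow> 0" "x = (\<lambda>i. t i - t (Suc i))"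
    "y = (\<lambda>i. - t i - t (Suc i))"
    using assms op_graph_S_iff by blast
  then show ?thesis
    using pairing_tails_sums[OF t(2)] by simp
qed

lemma skew_op_S: "skew_op S"
  using op_graph_S_pairing_sums by (auto simp: skew_op_def pairing_def sums_iff)

section \<open>Maximal monotonicity\<close>

text \<open>The operator is linear, so the difference of two graph elements is in the graph, where the
  pairing vanishes.\<close>

lemma monotone_set_op_graph_S: "monotone_set (op_graph S)"
  unfolding monotone_set_def
proof (intro conjI ballI op_graph_S_subset, clarify)
  fix x x' y y'
  assume xy: "(x, x') \<in> op_graph S" "(y, y') \<in> op_graph S"
  then have "x \<in> K" "y \<in> K" "x' \<in> S x" "y' \<in> S y"
    by (auto simp: op_graph_def S_def split: if_splits)
  from S_lincomb[OF this, of 1 "-1"] have "(x - y, x' - y') \<in> op_graph S"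
    by (simp add: op_graph_def fun_diff_def)
  from op_graph_S_pairing_sums[OF this] show "0 \<le> pairing (x - y) (x' - y')"
    by (simp add: pairing_def sums_iff)
qed

lemma affine_nonneg_imp_slope_zero:
  fixes p q :: real
  assumes "\<And>a. 0 \<le> p - a * q"
  shows "q = 0"
proof (rule ccontr)
  assume "q \<noteq> 0"
  with assms[of "(p + 1) / q"] show False
    by simp
qed

text \<open>The test elements have tail sums \<open>a\<close> at position \<open>m + 1\<close> and zero elsewhere; expanding the
  pairing gives a function of \<open>a\<close> that is affine by skewness.\<close>

lemma monotone_related_recurrence:
  assumes x: "x \<in> c0" "x' \<in> l1"
    and mono: "\<And>s s'. (s, s') \<in> op_graph S \<Longrightarrow> 0 \<le> pairing (s - x) (s' - x')"
  shows "x' (Suc m) - x' m = x m + x (Suc m)"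
proof -
  have "0 \<le> pairing x x' - a * (x' (Suc m) - x' m - x m - x (Suc m))" for a
  proof -
    define t :: rseq where "t = (\<lambda>i. if i = Suc m then a else 0)"
    define s where "s = (\<lambda>i. t i - t (Suc i))"
    define s' where "s' = (\<lambda>i. - t i - t (Suc i))"
    have "t \<longlonglongrightarrow> 0"
      by (rule tendsto_eventually, rule eventually_sequentiallyI[of "m + 2"])
        (simp add: t_def)
    moreover have "summable (\<lambda>p. \<bar>t p + t (Suc p)\<bar>)"
      by (rule summable_finite[of "{m, Suc m}"]) (auto simp: t_def)
    ultimately have s: "(s, s') \<in> op_graph S"
      unfolding op_graph_S_iff s_def s'_def by (intro exI[of _ t]) (simp add: t_def)
    have "(\<lambda>i. s i * x' i) sums (\<Sum>i\<in>{m, Suc m}. s i * x' i)"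
      "(\<lambda>i. x i * s' i) sums (\<Sum>i\<in>{m, Suc m}. x i * s' i)"
      by (rule sums_finite; auto simp: s_def s'_def t_def)+
    moreover have "(\<lambda>i. x i * x' i) sums pairing x x'"
      unfolding pairing_def using summable_pairing[OF x] by (rule summable_sums)
    ultimately have "pairing (s - x) (s' - x') =
        0 - (\<Sum>i\<in>{m, Suc m}. s i * x' i) - (\<Sum>i\<in>{m, Suc m}. x i * s' i) + pairing x x'"
      using op_graph_S_pairing_sums[OF s] by (intro pairing_diff_sums)
    then show ?thesis
      using mono[OF s] by (simp add: s_def s'_def t_def algebra_simps)
  qed
  from affine_nonneg_imp_slope_zero[OF this] show ?thesis
    by simp
qed

text \<open>Summing the recurrence expresses \<open>x'\<close> through the partial sums \<open>P\<close> of \<open>x\<close>: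
  \<open>x' n = P n + P (n + 1) - c\<close> with \<open>c = x 0 - x' 0\<close>.  Since \<open>x'\<close> and \<open>x\<close> are null sequences,
  \<open>P n + P (n + 1) = 2 * P n + x n\<close> tends to \<open>c\<close>, and so \<open>P\<close> tends to \<open>c / 2\<close>.\<close>

lemma recurrence_imp_tails:
  fixes x x' :: rseq
  assumes x: "x \<longlonglongrightarrow> 0" "x' \<longlonglongrightarrow> 0"
    and rec: "\<And>m. x' (Suc m) - x' m = x m + x (Suc m)"
  obtains t where "t \<longlonglongrightarrow> 0" "x = (\<lambda>i. t i - t (Suc i))" "x' = (\<lambda>i. - t i - t (Suc i))"
proof -
  define c where "c = x 0 - x' 0"
  have x': "x' n = 2 * (\<Sum>i<n. x i) + x n - c" for n
  proof (induction n)
    case (Suc n)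
    then show ?case
      using rec[of n] by simp
  qed (simp add: c_def)
  have "(\<lambda>n. (x' n - x n + c) / 2) \<longlonglongrightarrow> (0 - 0 + c) / 2"
    by (intro tendsto_intros x) simp
  then have sums: "x sums (c / 2)"
    by (simp add: sums_def x')
  show thesis
  proof (rule that)
    show "tail_sum x \<longlonglongrightarrow> 0"
      using tail_sum_null[OF sums] .
    show "x = (\<lambda>i. tail_sum x i - tail_sum x (Suc i))"
      "x' = (\<lambda>i. - tail_sum x i - tail_sum x (Suc i))"
      using tail_sum_eq_sum_diff[OF sums] by (auto simp: x')
  qed
qed

lemma monotone_related_imp_in_graph:
  assumes x: "x \<in> c0" "x' \<in> l1"
    and mono: "\<And>s s'. (s, s') \<in> op_graph S \<Longrightarrow> 0 \<le> pairing (s - x) (s' - x')"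
  shows "(x, x') \<in> op_graph S"
proof -
  have "x' \<longlonglongrightarrow> 0"
    using x(2) by (auto simp: l1_def intro: summable_LIMSEQ_zero summable_rabs_cancel)
  then obtain t where t: "t \<longlonglongrightarrow> 0" "x = (\<lambda>i. t i - t (Suc i))"
    "x' = (\<lambda>i. - t i - t (Suc i))"
    using recurrence_imp_tails[of x x'] monotone_related_recurrence[OF x mono] x(1)
    by (auto simp: c0_def)
  \<comment> \<open>Testing against the origin, which is in the graph, forces the total sum to vanish.\<close>
  have "((\<lambda>_. 0), (\<lambda>_. 0)) \<in> op_graph S"
    unfolding op_graph_S_iff by (intro exI[of _ "\<lambda>_. 0"]) simp
  from mono[OF this] have "0 \<le> pairing x x'"
    by (simp add: pairing_def)
  also have "pairing x x' = - (t 0)\<^sup>2"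
    using pairing_tails_sums[OF t(1)] by (simp add: pairing_def sums_iff t)
  finally have "t 0 = 0"
    by simp
  moreover have "\<bar>- t p - t (Suc p)\<bar> = \<bar>t p + t (Suc p)\<bar>" for p
    by simp
  then have "summable (\<lambda>p. \<bar>t p + t (Suc p)\<bar>)"
    using x(2) by (simp add: l1_def t)
  ultimately show ?thesis
    unfolding op_graph_S_iff using t by blast
qed

lemma maximally_monotone_op_S: "maximally_monotone_op S"
  unfolding maximally_monotone_op_def maximally_monotone_set_def
proof (intro conjI allI impI monotone_set_op_graph_S)
  fix B
  assume B: "monotone_set B" "op_graph S \<subseteq> B"
  have "B \<subseteq> op_graph S"
  proof clarify
    fix x x'
    assume x: "(x, x') \<in> B"
    show "(x, x') \<in> op_graph S"
    proof (rule monotone_related_imp_in_graph)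
      show "x \<in> c0" "x' \<in> l1"
        using B(1) x by (auto simp: monotone_set_def)
      show "0 \<le> pairing (s - x) (s' - x')" if "(s, s') \<in> op_graph S" for s s'
        using B x that unfolding monotone_set_def by blast
    qed
  qed
  with B(2) show "B = op_graph S"
    by simp
qed

section \<open>Failure of quasidensity\<close>

definition first_unit :: rseq where
  "first_unit = (\<lambda>i. if i = 0 then 1 else 0)"

text \<open>The bounded sequence \<open>(1, -2, 2, -2, \<dots>)\<close>, multiplied by \<open>1, 3/4, 1/2, 1/4, 0, 0, \<dots>\<close>.\<close>

definition damped_alternating :: rseq where
  "damped_alternating = (\<lambda>i. if i = 0 then 1 else if i = 1 then - 3/2 else if i = 2 then 1
                             else if i = 3 then - 1/2 else 0)"

lemma first_unit_l1: "first_unit \<in> l1"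
  unfolding l1_def mem_Collect_eq
  by (rule summable_finite[of "{0}"]) (auto simp: first_unit_def)

lemma damped_alternating_null: "damped_alternating \<longlonglongrightarrow> 0"
  by (rule tendsto_eventually, rule eventually_sequentiallyI[of 4])
    (simp add: damped_alternating_def)

text \<open>The alternating sum of the \<open>t p + t (p + 1)\<close> telescopes to \<open>t 0\<close>.\<close>

lemma abs_head_le_suminf:
  fixes t :: rseq
  assumes t: "t \<longlonglongrightarrow> 0" and sum: "summable (\<lambda>p. \<bar>t p + t (Suc p)\<bar>)"
  shows "\<bar>t 0\<bar> \<le> (\<Sum>p. \<bar>t p + t (Suc p)\<bar>)"
proof -
  have "(\<lambda>p. (-1) ^ p * t p) \<longlonglongrightarrow> 0"
    using t by (subst tendsto_rabs_zero_iff[symmetric]) (simp add: abs_mult tendsto_rabs_zero)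
  from telescoping_sums_null[OF this] have "(\<lambda>p. (-1) ^ p * (t p + t (Suc p))) sums t 0"
    by (simp add: algebra_simps)
  moreover have "\<bar>(-1) ^ p * (t p + t (Suc p))\<bar> = \<bar>t p + t (Suc p)\<bar>" for p
    by (simp add: abs_mult)
  ultimately show ?thesis
    using summable_rabs[of "\<lambda>p. (-1) ^ p * (t p + t (Suc p))"] sum by (simp add: sums_iff)
qed

text \<open>Let \<open>N\<close> be the distance from \<open>S s\<close> to the first unit vector, and \<open>t\<close> the tail sums of \<open>s\<close>.  Both bounds come from
  the fact that \<open>\<bar>t n\<bar>\<close> is at most the \<open>\<ell>\<^sub>1\<close> norm of \<open>S s\<close> from position \<open>n\<close> on: its use for
  \<open>n = 1\<close> gives \<open>1 \<le> N\<close>, and its use for \<open>n = 2\<close> gives \<open>- s 1 = t 2 - t 1 \<le> 1 + N\<close>.\<close>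

lemma l1_dist_unit_bounds:
  assumes "(s, s') \<in> op_graph S"
  shows "1 \<le> l1_norm (s' - first_unit)" and "- s 1 \<le> 1 + l1_norm (s' - first_unit)"
proof -
  obtain t where t: "t 0 = 0" "t \<longlonglongrightarrow> 0" "summable (\<lambda>p. \<bar>t p + t (Suc p)\<bar>)"
    "s = (\<lambda>i. t i - t (Suc i))" "s' = (\<lambda>i. - t i - t (Suc i))"
    using assms op_graph_S_iff by blast
  define T where "T n = (\<Sum>p. \<bar>t (p + n) + t (Suc (p + n))\<bar>)" for n
  have sum: "summable (\<lambda>p. \<bar>t (p + n) + t (Suc (p + n))\<bar>)" for n
    using summable_ignore_initial_segment[OF t(3), of n] .
  have tail: "\<bar>t n\<bar> \<le> T n" for n
    unfolding T_def
    using abs_head_le_suminf[of "\<lambda>p. t (p + n)"] LIMSEQ_ignore_initial_segment[OF t(2), of n]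
      sum[of n] by simp
  have T1: "T 1 = \<bar>t 1 + t 2\<bar> + T 2"
    using suminf_split_head[OF sum[of 1]] by (simp add: T_def numeral_2_eq_2)
  have eq: "\<bar>(s' - first_unit) (Suc p)\<bar> = \<bar>t (p + 1) + t (Suc (p + 1))\<bar>" for p
    by (simp add: first_unit_def t)
  then have "summable (\<lambda>p. \<bar>(s' - first_unit) (Suc p)\<bar>)"
    using sum[of 1] by simp
  then have "summable (\<lambda>p. \<bar>(s' - first_unit) p\<bar>)"
    by (subst (asm) summable_Suc_iff)
  from suminf_split_head[OF this] have N: "l1_norm (s' - first_unit) = \<bar>- t 1 - 1\<bar> + T 1"
    unfolding eq l1_norm_def T_def by (simp add: first_unit_def t)
  show "1 \<le> l1_norm (s' - first_unit)"
    using N tail[of 1] by linarith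
  have "- s 1 = t 2 - t 1"
    by (simp add: t numeral_2_eq_2)
  with N T1 tail[of 2] show "- s 1 \<le> 1 + l1_norm (s' - first_unit)"
    by linarith
qed

text \<open>Write \<open>\<sigma>\<close> and \<open>N\<close> for the two distances and \<open>t\<close> for the tail sums of \<open>s\<close>.  Each of the four
  damping steps, of size \<open>1/4\<close>, changes the pairing from its undamped value \<open>1\<close> by
  \<open>- (-1) ^ n * t n / 2\<close>, for \<open>n = 1, \<dots>, 4\<close>.  These changes combine in pairs to give
  \<open>1 + (s 1 + s 3) / 2\<close>.  Since the entry of \<open>damped_alternating\<close> at 3 is \<open>-1/2\<close>, we have
  \<open>- s 3 \<le> 1/2 + \<sigma>\<close>; together with \<open>- s 1 \<le> 1 + N\<close> this bounds the functional from below by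
  \<open>(\<sigma> - 1/2)\<^sup>2 / 2 + (N\<^sup>2 - N) / 2 + 1/8\<close>, where \<open>N \<ge> 1\<close>.\<close>

lemma quasidensity_gap:
  assumes s: "(s, s') \<in> op_graph S"
  shows "1/8 \<le> 1/2 * (c0_norm (s - damped_alternating))\<^sup>2 + 1/2 * (l1_norm (s' - first_unit))\<^sup>2
                + pairing (s - damped_alternating) (s' - first_unit)"
proof -
  define \<sigma> where "\<sigma> = c0_norm (s - damped_alternating)"
  define N where "N = l1_norm (s' - first_unit)"
  have "(\<lambda>i. s i * first_unit i) sums (\<Sum>i\<in>{0,1,2,3}. s i * first_unit i)"
    "(\<lambda>i. damped_alternating i * s' i) sums (\<Sum>i\<in>{0,1,2,3}. damped_alternating i * s' i)"
    "(\<lambda>i. damped_alternating i * first_unit i) sums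
       (\<Sum>i\<in>{0,1,2,3}. damped_alternating i * first_unit i)"
    by (rule sums_finite; auto simp: damped_alternating_def first_unit_def)+
  from pairing_diff_sums[OF op_graph_S_pairing_sums[OF s] this(3,1,2)]
  have "pairing (s - damped_alternating) (s' - first_unit) =
      1 - s 0 - s' 0 + 3/2 * s' 1 - s' 2 + 1/2 * s' 3"
    by (simp add: damped_alternating_def first_unit_def)
  moreover obtain t where "t 0 = 0" "s = (\<lambda>i. t i - t (Suc i))" "s' = (\<lambda>i. - t i - t (Suc i))"
    using s op_graph_S_iff by blast
  ultimately have pair: "pairing (s - damped_alternating) (s' - first_unit) = 1 + (s 1 + s 3) / 2"
    by (simp add: eval_nat_numeral field_simps)
  have "s - damped_alternating \<in> c0"
    using s op_graph_S_subset damped_alternating_null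
    by (auto simp: c0_def fun_diff_def intro!: tendsto_eq_intros)
  from c0_abs_le_norm[OF this, of 3] have "- s 3 \<le> 1/2 + \<sigma>"
    by (simp add: damped_alternating_def \<sigma>_def)
  moreover have N: "1 \<le> N" "- s 1 \<le> 1 + N"
    using l1_dist_unit_bounds[OF s] by (simp_all add: N_def first_unit_def)
  moreover have "N \<le> N\<^sup>2" "0 \<le> (\<sigma> - 1/2)\<^sup>2"
    using N(1) by (simp_all add: self_le_power)
  ultimately show ?thesis
    unfolding pair \<sigma>_def[symmetric] N_def[symmetric]
    by (simp add: power2_diff power_divide field_simps)
qed

lemma not_quasidense_op_S: "\<not> quasidense_op S"
proof
  assume "quasidense_op S"
  moreover have "damped_alternating \<in> c0"
    using damped_alternating_null by (simp add: c0_def)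
  moreover have "ereal (1/8) \<le> (INF (s, s') \<in> op_graph S.
      ereal (1/2 * (c0_norm (s - damped_alternating))\<^sup>2 + 1/2 * (l1_norm (s' - first_unit))\<^sup>2
             + pairing (s - damped_alternating) (s' - first_unit)))"
    using quasidensity_gap by (intro INF_greatest) auto
  ultimately have "ereal (1/8) \<le> 0"
    using first_unit_l1 unfolding quasidense_op_def by (meson order_trans)
  then show False
    by (simp add: zero_ereal_def)
qed

theorem theorem10p3:
  "skew_op S \<and> maximally_monotone_op S \<and> \<not> quasidense_op S"
  using skew_op_S maximally_monotone_op_S not_quasidense_op_S by blast

end
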